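(* Let $n\ge1$ and let $T$ be any binary tree with $n+1$ leaves. Then the pair of subsets $\mathcal G=\mathcal D_T$ and $\mathcal F=\mathcal A_T$ of the ball structure forms a torsion pair $(\mathcal G,\mathcal F)$.
   Context: A binary tree is a finite planar rooted tree in which every internal node has exactly two children. Let $T$ have $n+1$ leaves, numbered $0,1,\dots,n$ from left to right and drawn on the bottom level; the node whose subtree has leaves $i,i+1,\dots,j$ is drawn at the grid vertex $v_{i,j}=\left(\tfrac{i+j}{2},\tfrac{j-i}{2}\right)$. Edges of the tree are straight diagonal lines: descending (going down to the right; to right children, $j$ constant) or ascending (going up to the right; to left children, $i$ constant). Ball structure. The balls are indexed by pairs $[i,j]$ with $1\le i\le j\le n-1$; the ball $[i,j]$ fills the unit diamond with lowest corner $v_{i,j}$, left corner $v_{i-1,j}$, right corner $v_{i,j+1}$ and top corner $v_{i-1,j+1}$. (The balls represent the indecomposable objects of the category of representations of the linearly oriented quiver of type $A_{n-1}$; there are $n-1$ balls on the bottom row.) Hom. $\mathrm{Hom}(X,Y)\ne0$ if and only if the entire rectangle with left corner $X$ and right corner $Y$ lies in the ball structure; explicitly, $\mathrm{Hom}([i,j],[i',j'])\neq0$ if and only if $i\le i'\le j\le j'$. Torsion pair. A pair $(\mathcal G,\mathcal F)$ of subsets of balls is a torsion pair if $\mathcal G=\{X:\mathrm{Hom}(X,Y)=0\ \text{for all } Y\in\mathcal F\}$ and $\mathcal F=\{Y:\mathrm{Hom}(X,Y)=0\ \text{for all } X\in\mathcal G\}$. $\mathcal D_T$ is the set of balls sitting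 (directly) on descending edges of $T$: $[i,j]\in\mathcal D_T$ iff the lower-left side of its diamond, from $v_{i-1,j}$ to $v_{i,j}$, lies on a descending edge of $T$; equivalently, iff $a_j<i$, where $\{a_j,\dots,j\}$ is the leaf set of the largest subtree of $T$ whose rightmost leaf is $j$. $\mathcal A_T$ is the set of balls sitting on ascending edges of $T$: $[i,j]\in\mathcal A_T$ iff the lower-right side of its diamond, from $v_{i,j}$ to $v_{i,j+1}$, lies on an ascending edge of $T$; equivalently, iff $j<b_i$, where $\{i,\dots,b_i\}$ is the leaf set of the largest subtree of $T$ whose leftmost leaf is $i$. *)

theory Defs
  imports "HOL-Analysis.Analysis" "HOL-Library.Tree"
begin

text \<open>
  In the library type of trees, \<open>Leaf\<close> is a leaf and \<open>Node l x r\<close> an internal node with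
  exactly two children \<open>l\<close>, \<open>r\<close>; \<open>size\<close> counts internal nodes and
  \<open>size1\<close> counts leaves.
\<close>

type_synonym binary_tree = "unit tree"

definition grid_vertex :: "nat \<Rightarrow> nat \<Rightarrow> real \<times> real" where
  "grid_vertex i j = ((real i + real j) / 2, (real j - real i) / 2)"

text \<open>
  \<open>(k, S) \<in> subtrees_at a T\<close> means that \<open>S\<close> is the subtree of \<open>T\<close> below some node, and \<open>k\<close>
  is its leftmost leaf, when the leaves of \<open>T\<close> are numbered \<open>a, a + 1, \<dots>\<close> from left to right.
  The leaf set of \<open>S\<close> is then \<open>{k..k + size S}\<close>.
\<close>

fun subtrees_at :: "nat \<Rightarrow> binary_tree \<Rightarrow> (nat \<times> binary_tree) set" where
  "subtrees_at a Leaf = {(a, Leaf)}"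
| "subtrees_at a (Node l x r) =
     insert (a, Node l x r) (subtrees_at a l \<union> subtrees_at (a + size1 l) r)"

definition node_position :: "nat \<Rightarrow> binary_tree \<Rightarrow> real \<times> real" where
  "node_position k S = grid_vertex k (k + size S)"

definition descending_edges :: "binary_tree \<Rightarrow> (real \<times> real) set set" where
  "descending_edges T =
     {closed_segment (node_position k (Node l x r)) (node_position (k + size1 l) r)
       | k l x r. (k, Node l x r) \<in> subtrees_at 0 T}"

definition ascending_edges :: "binary_tree \<Rightarrow> (real \<times> real) set set" where
  "ascending_edges T =
     {closed_segment (node_position k l) (node_position k (Node l x r))
       | k l x r. (k, Node l x r) \<in> subtrees_at 0 T}"

type_synonym ball = "nat \<times> nat"

definition balls :: "nat \<Rightarrow> ball set" where
  "balls n = {(i, j). 1 \<le> i \<and> i \<le> j \<and> j \<le> n - 1}"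

text \<open>
  The two lower sides of the diamond filled by a ball.  The natural number subtraction is
  harmless, as \<open>i \<ge> 1\<close> for every ball \<open>(i, j)\<close>.
\<close>

fun lower_left_side :: "ball \<Rightarrow> (real \<times> real) set" where
  "lower_left_side (i, j) = closed_segment (grid_vertex (i - 1) j) (grid_vertex i j)"

fun lower_right_side :: "ball \<Rightarrow> (real \<times> real) set" where
  "lower_right_side (i, j) = closed_segment (grid_vertex i j) (grid_vertex i (j + 1))"

definition descending_balls :: "nat \<Rightarrow> binary_tree \<Rightarrow> ball set" where
  "descending_balls n T = {X \<in> balls n. \<exists>e \<in> descending_edges T. lower_left_side X \<subseteq> e}"

definition ascending_balls :: "nat \<Rightarrow> binary_tree \<Rightarrow> ball set" where
  "ascending_balls n T = {X \<in> balls n. \<exists>e \<in> ascending_edges T. lower_right_side X \<subseteq> e}"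

text \<open>
  \<open>hom_nonzero X Y\<close> is the assertion that \<open>Hom(X, Y)\<close> is nonzero: the rectangle of balls with
  left corner \<open>X\<close> and right corner \<open>Y\<close> lies in the ball structure.
\<close>

fun hom_nonzero :: "ball \<Rightarrow> ball \<Rightarrow> bool" where
  "hom_nonzero (i, j) (i', j') \<longleftrightarrow> i \<le> i' \<and> i' \<le> j \<and> j \<le> j'"

definition torsion_pair :: "nat \<Rightarrow> ball set \<Rightarrow> ball set \<Rightarrow> bool" where
  "torsion_pair n G F \<longleftrightarrow>
     G = {X \<in> balls n. \<forall>Y \<in> F. \<not> hom_nonzero X Y} \<and>
     F = {Y \<in> balls n. \<forall>X \<in> G. \<not> hom_nonzero X Y}"

end

(* Leaf sets of subtrees form a laminar family, which rules out nonzero maps from descending to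
   ascending balls. For maximality, consider the node separating two consecutive leaves. If the
   left subtree of the node between leaves j and j + 1 starts at leaf k, then either k < i and
   [i, j] sits on a descending edge, or i <= k and [i, j] maps to the ascending ball [k, j].
   The dual claim uses the node between leaves i - 1 and i. *)

theory Submission
  imports Defs
begin

text \<open>The first index varies affinely along such a segment while the second stays
  fixed.\<close>

lemma grid_vertex_in_descending_segment:
  assumes "k \<le> k'"
  shows "grid_vertex p q \<in> closed_segment (grid_vertex k m) (grid_vertex k' m) \<longleftrightarrow>
    q = m \<and> k \<le> p \<and> p \<le> k'"
proof
  assume "grid_vertex p q \<in> closed_segment (grid_vertex k m) (grid_vertex k' m)"
  then obtain u where u: "0 \<le> u" "u \<le> 1"
    and *: "(real p + real q) / 2 = (1 - u) * ((real k + real m) / 2) + u * ((real k' + real m) / 2)"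
      "(real q - real p) / 2 = (1 - u) * ((real m - real k) / 2) + u * ((real m - real k') / 2)"
    by (auto simp: closed_segment_def grid_vertex_def)
  \<comment> \<open>The sum of the two coordinates of a grid vertex is its second index, their
    difference the first.\<close>
  have q: "real q = real m" and p: "real p = real k + u * (real k' - real k)"
    using * by (simp_all add: field_simps)
  have "0 \<le> u * (real k' - real k)" "u * (real k' - real k) \<le> real k' - real k"
    using u assms by (simp_all add: mult_left_le_one_le)
  then have "real k \<le> real p" "real p \<le> real k'" using p by auto
  then show "q = m \<and> k \<le> p \<and> p \<le> k'" using q by simp
next
  assume *: "q = m \<and> k \<le> p \<and> p \<le> k'"
  show "grid_vertex p q \<in> closed_segment (grid_vertex k m) (grid_vertex k' m)"
  proof (cases "k = k'")
    case True
    with * show ?thesis by auto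
  next
    case False
    with assms have less: "real k < real k'" by simp
    define u where "u = (real p - real k) / (real k' - real k)"
    have "real p = real k + u * (real k' - real k)" using less by (simp add: u_def)
    then have "grid_vertex p q = (1 - u) *\<^sub>R grid_vertex k m + u *\<^sub>R grid_vertex k' m"
      using * by (simp add: grid_vertex_def field_simps)
    moreover have "0 \<le> u" "u \<le> 1" using * less by (auto simp: u_def divide_simps)
    ultimately show ?thesis unfolding closed_segment_def by blast
  qed
qed

text \<open>Negating the second coordinate swaps the two indices of a grid vertex and turns
  ascending lines into descending ones.\<close>

lemma grid_vertex_in_ascending_segment:
  assumes "m \<le> m'"
  shows "grid_vertex p q \<in> closed_segment (grid_vertex k m) (grid_vertex k m') \<longleftrightarrow>
    p = k \<and> m \<le> q \<and> q \<le> m'"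
proof -
  have refl: "(a, b) \<in> closed_segment (c, d) (e, f) \<longleftrightarrow> (a, -b) \<in> closed_segment (c, -d) (e, -f)"
    for a b c d e f :: real
    by (auto simp: closed_segment_def algebra_simps)
  have "grid_vertex p q \<in> closed_segment (grid_vertex k m) (grid_vertex k m') \<longleftrightarrow>
    grid_vertex q p \<in> closed_segment (grid_vertex m k) (grid_vertex m' k)"
    unfolding grid_vertex_def by (subst refl) (simp add: add.commute minus_divide_left)
  then show ?thesis using grid_vertex_in_descending_segment[OF assms] by simp
qed

text \<open>Turns geometry into leaf arithmetic: by convexity only the endpoints of the side matter.
  Their first indices are \<open>i - 1\<close> and \<open>i\<close>, and
  \<open>k \<le> i - 1\<close> becomes \<open>k < i\<close> because \<open>i \<ge> 1\<close> for a
  ball.\<close>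

lemma descending_balls_iff:
  "(i, j) \<in> descending_balls n T \<longleftrightarrow> (i, j) \<in> balls n \<and>
    (\<exists>k l x r. (k, Node l x r) \<in> subtrees_at 0 T \<and>
      j = k + size1 l + size r \<and> k < i \<and> i \<le> k + size1 l)"
proof -
  have "lower_left_side (i, j) \<subseteq>
      closed_segment (node_position k (Node l x r)) (node_position (k + size1 l) r) \<longleftrightarrow>
    j = k + size1 l + size r \<and> k < i \<and> i \<le> k + size1 l" if "(i, j) \<in> balls n"
    for k x and l r :: binary_tree
    using that grid_vertex_in_descending_segment[of k "k + size1 l" _ _ "k + size1 l + size r"]
    by (auto simp: subset_closed_segment node_position_def balls_def
        size1_size add.assoc)
  then show ?thesis
    unfolding descending_balls_def descending_edges_def by blast
qed

lemma ascending_balls_iff: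
  "(i, j) \<in> ascending_balls n T \<longleftrightarrow> (i, j) \<in> balls n \<and>
    (\<exists>l x r. (i, Node l x r) \<in> subtrees_at 0 T \<and>
      i + size l \<le> j \<and> j < i + size1 l + size r)"
proof -
  have "lower_right_side (i, j) \<subseteq>
      closed_segment (node_position k l) (node_position k (Node l x r)) \<longleftrightarrow>
    i = k \<and> k + size l \<le> j \<and> j < k + size1 l + size r"
    for k x and l r :: binary_tree
    using grid_vertex_in_ascending_segment[of "k + size l" "k + size1 l + size r" _ _ k]
    by (auto simp: subset_closed_segment node_position_def
        size1_size add.assoc)
  moreover have "(i, j) \<in> ascending_balls n T \<longleftrightarrow> (i, j) \<in> balls n \<and>
    (\<exists>k l x r. (k, Node l x r) \<in> subtrees_at 0 T \<and>
      lower_right_side (i, j) \<subseteq> closed_segment (node_position k l) (node_position k (Node l x r)))"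
    unfolding ascending_balls_def ascending_edges_def by blast
  ultimately show ?thesis by auto
qed

lemma root_in_subtrees_at: "(a, T) \<in> subtrees_at a T"
  by (cases T) auto

lemma children_in_subtrees_at:
  assumes "(k, Node l x r) \<in> subtrees_at a T"
  shows "(k, l) \<in> subtrees_at a T" and "(k + size1 l, r) \<in> subtrees_at a T"
  using assms by (induction a T rule: subtrees_at.induct) (auto simp: root_in_subtrees_at)

lemma subtrees_at_bounds:
  "(k, S) \<in> subtrees_at a T \<Longrightarrow> a \<le> k \<and> k + size S \<le> a + size T"
  by (induction a T rule: subtrees_at.induct) (auto simp: size1_size)

text \<open>Laminarity: two subtrees in the same child of the root fall to induction, and the leaf
  ranges of different children are disjoint.\<close>

lemma subtrees_at_not_crossing:
  assumes "(k, S) \<in> subtrees_at a T" "(k', S') \<in> subtrees_at a T"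
    and "k < k'" "k' \<le> k + size S"
  shows "k' + size S' \<le> k + size S"
  using assms
proof (induction a T rule: subtrees_at.induct)
  case (1 a)
  then show ?case by simp
next
  case (2 a l x r)
  note bounds = subtrees_at_bounds[of k S] subtrees_at_bounds[of k' S']
  from 2 show ?case
    using bounds[of a l] bounds[of "a + size1 l" r] by (auto simp: size1_size)
qed

text \<open>The node sought is the lowest common ancestor of the leaves \<open>j\<close> and
  \<open>j + 1\<close>; its left subtree ends at \<open>j\<close>.\<close>

lemma separating_node:
  assumes "a \<le> j" "j < a + size T"
  obtains k l x r where "(k, Node l x r) \<in> subtrees_at a T" "k + size l = j"
proof -
  have "\<exists>k l x r. (k, Node l x r) \<in> subtrees_at a T \<and> k + size l = j"
    using assms
  proof (induction a T rule: subtrees_at.induct)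
    case (1 a)
    then show ?case by simp
  next
    case (2 a l x r)
    consider "j < a + size l" | "j = a + size l" | "a + size1 l \<le> j"
      unfolding size1_size by linarith
    then show ?case
    proof cases
      case 1
      with 2 show ?thesis by fastforce
    next
      case 2
      then show ?thesis by auto
    next
      case 3
      with 2 have "\<exists>k l' x' r'. (k, Node l' x' r') \<in> subtrees_at (a + size1 l) r \<and> k + size l' = j"
        by (auto simp: size1_size)
      then show ?thesis by auto
    qed
  qed
  then show ?thesis using that by blast
qed

text \<open>Walk down the right spine of \<open>S\<close>. Every node on it ends at leaf
  \<open>j\<close>, while the first leaf grows from \<open>k < i\<close> to
  \<open>j \<ge> i\<close>, so some edge passes from below \<open>i\<close> to \<open>i\<close> or
  beyond.\<close>

lemma descending_ball_of_subtree:
  assumes "(i, j) \<in> balls n" "(k, S) \<in> subtrees_at 0 T" "k + size S = j" "k < i"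
  shows "(i, j) \<in> descending_balls n T"
  using assms(2-)
proof (induction S arbitrary: k)
  case Leaf
  with assms(1) show ?case by (auto simp: balls_def)
next
  case (Node l x r)
  show ?case
  proof (cases "i \<le> k + size1 l")
    case True
    have "j = k + size1 l + size r" using Node.prems(2) by (simp add: size1_size)
    with True Node.prems assms(1) show ?thesis
      unfolding descending_balls_iff by blast
  next
    case False
    with Node.prems show ?thesis
      by (intro Node.IH(2)[of "k + size1 l"])
        (auto simp: size1_size dest: children_in_subtrees_at)
  qed
qed

text \<open>Dually, along the left spine the last leaf drops from beyond \<open>j\<close> to
  \<open>i \<le> j\<close>, and the edge where it first becomes at most \<open>j\<close> carries the
  ball.\<close>

lemma ascending_ball_of_subtree:
  assumes "(i, j) \<in> balls n" "(i, S) \<in> subtrees_at 0 T" "j < i + size S"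
  shows "(i, j) \<in> ascending_balls n T"
  using assms(2-)
proof (induction S)
  case Leaf
  with assms(1) show ?case by (auto simp: balls_def)
next
  case (Node l x r)
  show ?case
  proof (cases "i + size l \<le> j")
    case True
    have "j < i + size1 l + size r" using Node.prems(2) by (simp add: size1_size)
    with True Node.prems assms(1) show ?thesis
      unfolding ascending_balls_iff by blast
  next
    case False
    with Node.prems show ?thesis
      by (intro Node.IH(1)) (auto dest: children_in_subtrees_at)
  qed
qed

lemma hom_descending_ascending_zero:
  assumes "X \<in> descending_balls n T" "Y \<in> ascending_balls n T"
  shows "\<not> hom_nonzero X Y"
proof
  assume hom: "hom_nonzero X Y"
  obtain i j i' j' where XY: "X = (i, j)" "Y = (i', j')" by fastforce
  obtain k l x r where S: "(k, Node l x r) \<in> subtrees_at 0 T" "j = k + size1 l + size r" "k < i"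
    using assms(1) unfolding XY descending_balls_iff by blast
  obtain l' x' r' where S': "(i', Node l' x' r') \<in> subtrees_at 0 T" "j' < i' + size1 l' + size r'"
    using assms(2) unfolding XY ascending_balls_iff by blast
  \<comment> \<open>A nonzero map gives \<open>k < i \<le> i' \<le> j\<close>, so by laminarity the
    subtree at \<open>i'\<close> ends by \<open>j\<close>, yet it ends after
    \<open>j' \<ge> j\<close>.\<close>
  show False
    using subtrees_at_not_crossing[OF S(1) S'(1)] S(2,3) S'(2) hom
    by (simp add: XY size1_size)
qed

lemma descending_or_hom_to_ascending:
  assumes "X \<in> balls n" "size T = n" "X \<notin> descending_balls n T"
  shows "\<exists>Y \<in> ascending_balls n T. hom_nonzero X Y"
proof -
  obtain i j where X: "X = (i, j)" by fastforce
  \<comment> \<open>Since \<open>j \<ge> 1\<close>, the truncated \<open>n - 1\<close> is positive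
    and the bound is strict.\<close>
  have ij: "1 \<le> i" "i \<le> j" "j < n" using assms(1) by (auto simp: X balls_def)
  obtain k l x r where S: "(k, Node l x r) \<in> subtrees_at 0 T" "k + size l = j"
    using separating_node[of 0 j T] ij assms(2) by auto
  \<comment> \<open>Otherwise the right spine of \<open>l\<close>, which ends at \<open>j\<close>,
    would carry \<open>X\<close>.\<close>
  have "i \<le> k"
    using descending_ball_of_subtree[OF _ children_in_subtrees_at(1)[OF S(1)] S(2)] assms(1,3)
    by (force simp: X)
  then have "(k, j) \<in> balls n" "hom_nonzero X (k, j)"
    using ij S(2) by (auto simp: X balls_def)
  \<comment> \<open>The whole node starts at \<open>k\<close> and ends beyond
    \<open>j\<close>.\<close>
  moreover have "(k, j) \<in> ascending_balls n T"
    using ascending_ball_of_subtree[OF \<open>(k, j) \<in> balls n\<close> S(1)] S(2) by simp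
  ultimately show ?thesis by blast
qed

lemma ascending_or_hom_from_descending:
  assumes "Y \<in> balls n" "size T = n" "Y \<notin> ascending_balls n T"
  shows "\<exists>X \<in> descending_balls n T. hom_nonzero X Y"
proof -
  obtain i j where Y: "Y = (i, j)" by fastforce
  have ij: "1 \<le> i" "i \<le> j" "j < n" using assms(1) by (auto simp: Y balls_def)
  obtain k l x r where S: "(k, Node l x r) \<in> subtrees_at 0 T" "k + size l = i - 1"
    using separating_node[of 0 "i - 1" T] ij assms(2) by (metis add_0 le0 le_less_trans diff_le_self)
  have i: "i = k + size1 l" using S(2) ij by (simp add: size1_size)
  \<comment> \<open>The last leaf of \<open>r\<close>, hence also of the whole node, which starts at
    \<open>k < i\<close>.\<close>
  define b where "b = i + size r"
  \<comment> \<open>Otherwise the left spine of \<open>r\<close>, which starts at \<open>i\<close>,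
    would carry \<open>Y\<close>.\<close>
  have "b \<le> j"
    using ascending_ball_of_subtree[OF _ children_in_subtrees_at(2)[OF S(1)]] assms(1,3)
    by (force simp: Y i b_def)
  then have "(i, b) \<in> balls n" "hom_nonzero (i, b) Y"
    using ij by (auto simp: Y balls_def b_def)
  moreover have "(i, b) \<in> descending_balls n T"
    using descending_ball_of_subtree[OF \<open>(i, b) \<in> balls n\<close> S(1)] i
    by (simp add: b_def size1_size)
  ultimately show ?thesis by blast
qed

theorem theorem4p5:
  fixes n :: nat and T :: binary_tree
  assumes "n \<ge> 1" and "size1 T = n + 1"
  shows "torsion_pair n (descending_balls n T) (ascending_balls n T)"
proof -
  have "size T = n" using assms(2) by (simp add: size1_size)
  moreover have "descending_balls n T \<subseteq> balls n" "ascending_balls n T \<subseteq> balls n"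
    by (auto simp: descending_balls_def ascending_balls_def)
  ultimately show ?thesis
    \<comment> \<open>Vanishing of Hom gives one inclusion in each equation, the two existence
      lemmas the reverse ones.\<close>
    unfolding torsion_pair_def
    using hom_descending_ascending_zero descending_or_hom_to_ascending
      ascending_or_hom_from_descending
    by blast
qed

end
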